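(* Let $M\in\mathbb{R}^{n\times m}$ be a (left) stochastic matrix with $\operatorname{rank}M=r$. Then \[B_5(M)\le r^2(\ln m+1),\qquad\text{where}\qquad B_5(M)=\sum_{i=1}^n\max_{q^{(i)}}\frac{\sum_{k=1}^m q^{(i)}_kM(i,k)}{\sqrt{\sum_{s,t=1}^m q^{(i)}_sq^{(i)}_tF(M_s,M_t)^2}},\] each maximum being over all probability distributions $q^{(i)}=(q^{(i)}_1,\dots,q^{(i)}_m)$, and $M_s$ denoting the $s$-th column of $M$.
   Context: A (left) stochastic matrix has nonnegative entries and each column sums to $1$. For probability distributions $p=(p_k)_{k=1}^n$, $q=(q_k)_{k=1}^n$, the fidelity is $F(p,q)=\sum_{k=1}^n\sqrt{p_kq_k}$. $M(i,k)$ denotes the entry in row $i$, column $k$; $\ln$ is the natural logarithm. *)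

theory Defs
  imports "HOL-Analysis.Analysis"
begin

definition prob_dist :: "real ^ 'k \<Rightarrow> bool" where
  "prob_dist p \<longleftrightarrow> (\<forall>k. 0 \<le> p $ k) \<and> (\<Sum>k\<in>UNIV. p $ k) = 1"

definition left_stochastic :: "real ^ 'm ^ 'n \<Rightarrow> bool" where
  "left_stochastic M \<longleftrightarrow> (\<forall>i k. 0 \<le> M $ i $ k) \<and> (\<forall>k. (\<Sum>i\<in>UNIV. M $ i $ k) = 1)"

definition fidelity :: "real ^ 'k \<Rightarrow> real ^ 'k \<Rightarrow> real" where
  "fidelity p q = (\<Sum>k\<in>UNIV. sqrt (p $ k * q $ k))"

definition B5_ratio :: "real ^ 'm ^ 'n \<Rightarrow> 'n \<Rightarrow> real ^ 'm \<Rightarrow> real" where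
  "B5_ratio M i q =
     (\<Sum>k\<in>UNIV. q $ k * M $ i $ k) /
     sqrt (\<Sum>s\<in>UNIV. \<Sum>t\<in>UNIV. q $ s * q $ t * (fidelity (column s M) (column t M))\<^sup>2)"

text \<open>
  The maximum over all probability distributions is written as a supremum;
  lemma \<open>B5_max_attained\<close> shows that for a left stochastic matrix
  it is attained (each denominator is positive and the simplex is compact).
\<close>

definition B5 :: "real ^ 'm ^ 'n \<Rightarrow> real" where
  "B5 M = (\<Sum>i\<in>UNIV. SUP q\<in>{q. prob_dist q}. B5_ratio M i q)"

lemma fidelity_self_column:
  assumes "left_stochastic M"
  shows "fidelity (column s M) (column s M) = 1"
  using assms by (simp add: fidelity_def left_stochastic_def column_def)

lemma B5_denominator_pos:
  fixes M :: "real ^ 'm ^ 'n" and q :: "real ^ 'm"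
  assumes M: "left_stochastic M" and q: "prob_dist q"
  shows "0 < (\<Sum>s\<in>UNIV. \<Sum>t\<in>UNIV.
           q $ s * q $ t * (fidelity (column s M) (column t M))\<^sup>2)"
proof -
  have nn: "0 \<le> q $ k" for k
    using q by (simp add: prob_dist_def)
  obtain s where "q $ s \<noteq> 0"
    using q by (metis prob_dist_def sum.neutral zero_neq_one)
  with nn have s: "0 < q $ s"
    by (metis order_le_less)
  let ?f = "\<lambda>s t. q $ s * q $ t * (fidelity (column s M) (column t M))\<^sup>2"
  have f0: "0 \<le> ?f s t" for s t
    by (simp add: nn)
  have "0 < ?f s s"
    using s by (simp add: fidelity_self_column[OF M])
  also have "\<dots> \<le> (\<Sum>t\<in>UNIV. ?f s t)"
    by (rule member_le_sum) (auto intro: f0)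
  also have "\<dots> \<le> (\<Sum>s\<in>UNIV. \<Sum>t\<in>UNIV. ?f s t)"
    by (rule member_le_sum[where f = "\<lambda>s. \<Sum>t\<in>UNIV. ?f s t"]) (auto intro: sum_nonneg f0)
  finally show ?thesis .
qed

lemma compact_prob_dist: "compact {q :: real ^ 'm. prob_dist q}"
proof -
  have eq: "{q :: real ^ 'm. prob_dist q} =
      cbox 0 1 \<inter> {q. (\<Sum>k\<in>UNIV. q $ k) = 1}"
  proof (intro set_eqI iffI)
    fix q :: "real ^ 'm"
    assume "q \<in> {q. prob_dist q}"
    then have nn: "\<And>k. 0 \<le> q $ k" and one: "(\<Sum>k\<in>UNIV. q $ k) = 1"
      by (auto simp: prob_dist_def)
    have "q $ k \<le> 1" for k
      using member_le_sum[of k UNIV "\<lambda>k. q $ k"] nn one by simp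
    with nn one show "q \<in> cbox 0 1 \<inter> {q. (\<Sum>k\<in>UNIV. q $ k) = 1}"
      by (simp add: mem_box_cart)
  qed (auto simp: prob_dist_def mem_box_cart)
  have "closed {q :: real ^ 'm. (\<Sum>k\<in>UNIV. q $ k) = 1}"
    by (intro closed_Collect_eq continuous_intros)
  then show ?thesis
    unfolding eq by (intro compact_Int_closed compact_cbox)
qed

lemma prob_dist_axis: "prob_dist (axis k 1)"
  by (auto simp: prob_dist_def axis_def)

lemma B5_max_attained:
  fixes M :: "real ^ 'm ^ 'n" and i :: 'n
  assumes M: "left_stochastic M"
  shows "\<exists>q. prob_dist q \<and> (\<forall>p. prob_dist p \<longrightarrow> B5_ratio M i p \<le> B5_ratio M i q) \<and>
             (SUP q\<in>{q. prob_dist q}. B5_ratio M i q) = B5_ratio M i q"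
proof -
  let ?S = "{q :: real ^ 'm. prob_dist q}"
  have cont: "continuous_on ?S (B5_ratio M i)"
    unfolding B5_ratio_def
    by (intro continuous_intros ballI)
       (use B5_denominator_pos[OF M] in \<open>force dest: less_imp_neq\<close>)
  have ne: "?S \<noteq> {}"
    using prob_dist_axis by blast
  obtain q where q: "q \<in> ?S" and max: "\<And>p. p \<in> ?S \<Longrightarrow> B5_ratio M i p \<le> B5_ratio M i q"
    using continuous_attains_sup[OF compact_prob_dist ne cont] by blast
  have "(SUP q\<in>?S. B5_ratio M i q) = B5_ratio M i q"
    by (rule cSup_eq_maximum) (use q max in auto)
  with q max show ?thesis by blast
qed

end

theory Submission imports Defs begin

text \<open>
  Write \<open>w\<^sub>i = max\<^sub>k M(i,k)\<close> and \<open>W = \<Sum>\<^sub>i w\<^sub>i\<close>. The squared denominator in \<open>B\<^sub>5\<close> is the squared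
  Frobenius norm of \<open>\<rho> = \<Sum>\<^sub>s q\<^sub>s u\<^sub>s u\<^sub>s\<^sup>T\<close>, where \<open>u\<^sub>s\<close> is the entrywise square root of the column
  \<open>M\<^sub>s\<close>. Testing \<open>\<rho>\<close> against the matrix with entries \<open>sqrt (w\<^sub>a w\<^sub>b)\<close>, of Frobenius norm \<open>W\<close>, bounds
  the denominator below by \<open>1 / W\<close>; hence \<open>B\<^sub>5 \<le> W\<^sup>2\<close>. Finally \<open>W \<le> r\<close>: the columns
  contain a basis of their span (one of maximal volume) in which every column has all its coefficients
  in \<open>[-1, 1]\<close>, so \<open>w\<^sub>i\<close> is at most the \<open>i\<close>-th entry of the sum of the \<open>r\<close> basis columns. This gives
  the bound even without the logarithm.
\<close>

text \<open>Extending a basis of the span of \<open>S\<close> to the whole space turns the volume of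
  \<open>dim S\<close> vectors into a full determinant. By Cramer's rule, a coefficient larger than
  1 in absolute value would allow an exchange that increases the volume.\<close>

lemma Auerbach_basis:
  fixes S :: "(real ^ 'n) set"
  assumes "finite S"
  obtains B where "B \<subseteq> S" "independent B" "card B = dim S"
    "\<And>v. v \<in> S \<Longrightarrow> \<exists>c. (\<forall>b\<in>B. \<bar>c b\<bar> \<le> 1) \<and> v = (\<Sum>b\<in>B. c b *\<^sub>R b)"
proof -
  obtain B\<^sub>0 where B\<^sub>0: "B\<^sub>0 \<subseteq> S" "independent B\<^sub>0" "card B\<^sub>0 = dim S"
    by (metis basis_exists)
  obtain D where D: "B\<^sub>0 \<subseteq> D" "independent D" "UNIV \<subseteq> span D"
    by (rule maximal_independent_subset_extend[OF subset_UNIV B\<^sub>0(2)])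
  have "card D = dim (UNIV :: (real ^ 'n) set)"
    using D basis_card_eq_dim by blast
  then have "card (UNIV :: 'n set) = card D"
    by simp
  then obtain h :: "'n \<Rightarrow> real ^ 'n" where h: "bij_betw h UNIV D"
    using bij_betw_iff_card[of "UNIV :: 'n set" D] D(2) independent_imp_finite by auto
  define J where "J = h -` B\<^sub>0"
  have "card (h ` J) = card J"
    using h by (metis bij_betw_def card_image inj_on_subset subset_UNIV)
  moreover have "h ` J = B\<^sub>0"
    using h D(1) unfolding J_def bij_betw_def by auto
  ultimately have cardJ: "card J = dim S"
    using B\<^sub>0 by simp
  \<comment> \<open>The slots in \<open>J\<close> range over \<open>S\<close>; the others keep the
    fixed padding vectors from \<open>h\<close>.\<close>
  define G where "G = {g :: 'n \<Rightarrow> real ^ 'n. (\<forall>j\<in>J. g j \<in> S) \<and> (\<forall>j. j \<notin> J \<longrightarrow> g j = h j)}"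
  have "G \<subseteq> PiE UNIV (\<lambda>j. S \<union> {h j})"
    unfolding G_def by auto
  then have finG: "finite G"
    by (rule finite_subset) (use assms in \<open>auto intro: finite_PiE\<close>)
  have hG: "h \<in> G"
    using B\<^sub>0(1) unfolding G_def J_def by auto
  define vol where "vol g = \<bar>det (\<chi> j. g j)\<bar>" for g :: "'n \<Rightarrow> real ^ 'n"
  obtain g where g: "g \<in> G" and Max_vol: "Max (vol ` G) = vol g"
    using obtains_MAX[OF finG] hG by (metis empty_iff)
  have max: "vol f \<le> vol g" if "f \<in> G" for f
    unfolding Max_vol[symmetric] using finG that by simp
  have rows_eq: "rows (\<chi> j. f j) = range f" for f :: "'n \<Rightarrow> real ^ 'n"
    by (auto simp: rows_def row_def)
  \<comment> \<open>The initial basis is itself a candidate with nonzero determinant, so the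
    maximizer \<open>g\<close> has independent rows.\<close>
  have "span (rows (\<chi> j. h j)) = UNIV"
    using D(3) h unfolding rows_eq bij_betw_def by auto
  then have "0 < vol h"
    unfolding vol_def
    by (metis invertible_det_nz invertible_left_inverse matrix_left_invertible_span_rows
        zero_less_abs_iff)
  with max[OF hG] have volg: "0 < vol g"
    by linarith
  then have det_nz: "det (\<chi> j. g j) \<noteq> 0"
    by (simp add: vol_def)
  have indep: "independent (range g)"
    using det_dependent_rows[of "\<chi> j. g j"] det_nz unfolding rows_eq dependent_vec_eq by blast
  have inj: "inj g"
  proof (rule injI, rule ccontr)
    fix i j assume "g i = g j" "i \<noteq> j"
    then show False
      using det_identical_rows[of i j "\<chi> j. g j"] det_nz by (simp add: row_def)
  qed
  have gJ: "g ` J \<subseteq> S"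
    using g unfolding G_def by auto
  have indJ: "independent (g ` J)"
    using indep by (rule independent_mono) auto
  have card_gJ: "card (g ` J) = dim S"
    using cardJ inj by (metis card_image inj_on_subset subset_UNIV)
  have "S \<subseteq> span (g ` J)"
    using card_ge_dim_independent[OF gJ indJ] card_gJ by simp
  have "\<exists>c. (\<forall>b\<in>g ` J. \<bar>c b\<bar> \<le> 1) \<and> v = (\<Sum>b\<in>g ` J. c b *\<^sub>R b)" if v: "v \<in> S" for v
  proof -
    have "v \<in> span (g ` J)"
      using v \<open>S \<subseteq> span (g ` J)\<close> by blast
    then obtain c where c: "v = (\<Sum>b\<in>g ` J. c b *\<^sub>R b)"
      using span_finite[of "g ` J"] by auto
    \<comment> \<open>Padding the coordinates by 0 outside \<open>J\<close> expands \<open>v\<close>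
      in all rows of \<open>g\<close>, the form Cramer's rule expects.\<close>
    define x :: "real ^ 'n" where "x = (\<chi> j. if j \<in> J then c (g j) else 0)"
    have "v = (\<Sum>j\<in>J. c (g j) *\<^sub>R g j)"
      unfolding c using inj by (subst sum.reindex) (auto intro: inj_on_subset)
    also have "\<dots> = (\<Sum>j\<in>UNIV. x $ j *\<^sub>R g j)"
      by (rule sum.mono_neutral_cong_left) (auto simp: x_def)
    finally have vx: "v = (\<Sum>j\<in>UNIV. x $ j *s g j)"
      by (simp add: scalar_mult_eq_scaleR)
    have "\<bar>c (g k)\<bar> \<le> 1" if k: "k \<in> J" for k
    proof -
      \<comment> \<open>Exchanging row \<open>k\<close> for \<open>v\<close> multiplies the
        determinant by \<open>x $ k\<close>, while maximality forbids a larger volume.\<close>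
      have "g(k := v) \<in> G"
        using g v k unfolding G_def by auto
      moreover have "det (\<chi> j. (g(k := v)) j) = x $ k * det (\<chi> j. g j)"
        using cramer_lemma_transpose[of k x "\<chi> j. g j"]
        by (simp add: vx row_def fun_upd_def if_distrib cong: if_cong)
      ultimately have "\<bar>x $ k\<bar> * vol g \<le> vol g"
        using max unfolding vol_def by (metis abs_mult)
      then show ?thesis
        using volg k by (simp add: x_def)
    qed
    with c show ?thesis by blast
  qed
  with gJ indJ card_gJ that show ?thesis by blast
qed

lemma sum_row_max_le_rank:
  fixes M :: "real ^ 'm ^ 'n"
  assumes M: "left_stochastic M"
  shows "(\<Sum>i\<in>UNIV. MAX k. M $ i $ k) \<le> real (rank M)"
proof -
  have "finite (columns M)"
    by (simp add: columns_def full_SetCompr_eq)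
  then obtain B where B: "B \<subseteq> columns M" "card B = dim (columns M)"
    and coeff: "\<And>v. v \<in> columns M \<Longrightarrow> \<exists>c. (\<forall>b\<in>B. \<bar>c b\<bar> \<le> 1) \<and> v = (\<Sum>b\<in>B. c b *\<^sub>R b)"
    by (rule Auerbach_basis) metis
  have nonneg: "0 \<le> b $ i" if "b \<in> B" for b i
    using that B(1) M unfolding columns_def column_def left_stochastic_def by auto
  have total: "(\<Sum>i\<in>UNIV. b $ i) = 1" if "b \<in> B" for b
    using that B(1) M unfolding columns_def column_def left_stochastic_def by auto
  have "M $ i $ k \<le> (\<Sum>b\<in>B. b $ i)" for i k
  proof -
    have "column k M \<in> columns M"
      unfolding columns_def by blast
    then obtain c where c: "\<forall>b\<in>B. \<bar>c b\<bar> \<le> 1" "column k M = (\<Sum>b\<in>B. c b *\<^sub>R b)"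
      using coeff by blast
    have "M $ i $ k = (\<Sum>b\<in>B. c b * b $ i)"
      using arg_cong[OF c(2), of "\<lambda>v. v $ i"] by (simp add: column_def)
    also have "\<dots> \<le> (\<Sum>b\<in>B. b $ i)"
    proof (rule sum_mono)
      fix b assume b: "b \<in> B"
      then have "c b \<le> 1"
        using c(1) by (auto simp: abs_le_iff)
      then show "c b * b $ i \<le> b $ i"
        using mult_right_mono[of "c b" 1 "b $ i"] nonneg[OF b] by simp
    qed
    finally show ?thesis .
  qed
  then have "(\<Sum>i\<in>UNIV. MAX k. M $ i $ k) \<le> (\<Sum>i\<in>UNIV. \<Sum>b\<in>B. b $ i)"
    by (intro sum_mono) simp
  also have "\<dots> = (\<Sum>b\<in>B. \<Sum>i\<in>UNIV. b $ i)"
    by (rule sum.swap)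
  \<comment> \<open>Each basis column has entry sum 1, so the double sum counts the basis.\<close>
  also have "\<dots> = real (rank M)"
    by (simp add: total B(2) column_rank_def)
  finally show ?thesis .
qed

lemma Cauchy_Schwarz_double_sum:
  fixes f g :: "'a \<Rightarrow> 'b \<Rightarrow> real"
  shows "(\<Sum>a\<in>A. \<Sum>b\<in>B. f a b * g a b)\<^sup>2 \<le> (\<Sum>a\<in>A. \<Sum>b\<in>B. (f a b)\<^sup>2) * (\<Sum>a\<in>A. \<Sum>b\<in>B. (g a b)\<^sup>2)"
  using Cauchy_Schwarz_ineq_sum[of "\<lambda>(a, b). f a b" "\<lambda>(a, b). g a b" "A \<times> B"]
  by (simp add: sum.cartesian_product case_prod_unfold)

lemma sum_swap_pairs:
  "(\<Sum>s\<in>A. \<Sum>t\<in>B. \<Sum>a\<in>C. \<Sum>b\<in>D. f s t a b) = (\<Sum>a\<in>C. \<Sum>b\<in>D. \<Sum>s\<in>A. \<Sum>t\<in>B. f s t a b)"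
  using sum.swap[of "\<lambda>(s, t) (a, b). f s t a b" "C \<times> D" "A \<times> B"]
  by (simp add: sum.cartesian_product')

text \<open>Cauchy-Schwarz for the Frobenius inner product of \<open>\<rho>\<close> with the
  rank-one matrix \<open>sqrt (w a) * sqrt (w b)\<close>: their pairing is at least 1.\<close>

lemma B5_denominator_ge:
  fixes M :: "real ^ 'm ^ 'n" and q :: "real ^ 'm"
  assumes M: "left_stochastic M" and q: "prob_dist q"
    and w: "\<And>i k. M $ i $ k \<le> w i"
  shows "1 \<le> (\<Sum>i\<in>UNIV. w i)\<^sup>2 *
    (\<Sum>s\<in>UNIV. \<Sum>t\<in>UNIV. q $ s * q $ t * (fidelity (column s M) (column t M))\<^sup>2)"
proof -
  define u where "u s a = sqrt (M $ a $ s)" for s a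
  define \<rho> where "\<rho> a b = (\<Sum>s\<in>UNIV. q $ s * (u s a * u s b))" for a b
  have M0: "0 \<le> M $ i $ k" for i k
    using M by (simp add: left_stochastic_def)
  have w0: "0 \<le> w i" for i
    using M0 w order_trans by blast
  have q0: "0 \<le> q $ s" for s
    using q by (simp add: prob_dist_def)
  \<comment> \<open>The fidelity is the inner product of \<open>u s\<close> and \<open>u t\<close>,
    so its square is the Frobenius inner product of their rank-one projections.\<close>
  have fid: "q $ s * q $ t * (fidelity (column s M) (column t M))\<^sup>2
      = (\<Sum>a\<in>UNIV. \<Sum>b\<in>UNIV. (q $ s * (u s a * u s b)) * (q $ t * (u t a * u t b)))" for s t
  proof -
    have "fidelity (column s M) (column t M) = (\<Sum>a\<in>UNIV. u s a * u t a)"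
      by (simp add: fidelity_def column_def u_def real_sqrt_mult)
    then show ?thesis
      by (simp add: power2_eq_square sum_product sum_distrib_left mult_ac)
  qed
  have norm: "(\<Sum>s\<in>UNIV. \<Sum>t\<in>UNIV. q $ s * q $ t * (fidelity (column s M) (column t M))\<^sup>2)
      = (\<Sum>a\<in>UNIV. \<Sum>b\<in>UNIV. (\<rho> a b)\<^sup>2)"
    unfolding fid by (subst sum_swap_pairs) (simp add: \<rho>_def power2_eq_square sum_product)
  have test: "(\<Sum>a\<in>UNIV. \<Sum>b\<in>UNIV. (sqrt (w a) * sqrt (w b))\<^sup>2) = (\<Sum>i\<in>UNIV. w i)\<^sup>2"
    by (simp add: w0 power_mult_distrib power2_eq_square[of "sum w UNIV"] sum_product)
  \<comment> \<open>Here \<open>sqrt (w a)\<close> dominates \<open>u s a\<close>, and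
    \<open>u s\<close> is a unit vector.\<close>
  have ge1: "1 \<le> (\<Sum>a\<in>UNIV. sqrt (w a) * u s a)" for s
  proof -
    have "1 = (\<Sum>a\<in>UNIV. M $ a $ s)"
      using M by (simp add: left_stochastic_def)
    also have "\<dots> \<le> (\<Sum>a\<in>UNIV. sqrt (w a) * u s a)"
    proof (rule sum_mono)
      fix a
      have "M $ a $ s = sqrt (M $ a $ s) * u s a"
        by (simp add: u_def M0)
      also have "\<dots> \<le> sqrt (w a) * u s a"
        by (intro mult_right_mono) (simp_all add: u_def M0 w)
      finally show "M $ a $ s \<le> sqrt (w a) * u s a" .
    qed
    finally show ?thesis .
  qed
  have "1 = (\<Sum>s\<in>UNIV. q $ s * 1)"
    using q by (simp add: prob_dist_def)
  also have "\<dots> \<le> (\<Sum>s\<in>UNIV. q $ s * (\<Sum>a\<in>UNIV. sqrt (w a) * u s a)\<^sup>2)"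
    by (intro sum_mono mult_left_mono) (simp_all add: q0 ge1)
  also have "\<dots> = (\<Sum>s\<in>UNIV. \<Sum>a\<in>UNIV. \<Sum>b\<in>UNIV.
      sqrt (w a) * sqrt (w b) * (q $ s * (u s a * u s b)))"
    by (simp add: power2_eq_square sum_product sum_distrib_left mult_ac)
  also have "\<dots> = (\<Sum>a\<in>UNIV. \<Sum>s\<in>UNIV. \<Sum>b\<in>UNIV.
      sqrt (w a) * sqrt (w b) * (q $ s * (u s a * u s b)))"
    by (rule sum.swap)
  also have "\<dots> = (\<Sum>a\<in>UNIV. \<Sum>b\<in>UNIV. sqrt (w a) * sqrt (w b) * \<rho> a b)"
    unfolding \<rho>_def sum_distrib_left by (intro sum.cong refl sum.swap)
  finally have "1 \<le> (\<Sum>a\<in>UNIV. \<Sum>b\<in>UNIV. sqrt (w a) * sqrt (w b) * \<rho> a b)\<^sup>2"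
    by simp
  also have "\<dots> \<le> (\<Sum>a\<in>UNIV. \<Sum>b\<in>UNIV. (sqrt (w a) * sqrt (w b))\<^sup>2) * (\<Sum>a\<in>UNIV. \<Sum>b\<in>UNIV. (\<rho> a b)\<^sup>2)"
    by (rule Cauchy_Schwarz_double_sum)
  finally show ?thesis
    unfolding norm test .
qed

theorem theorem4:
  fixes M :: "real ^ 'm ^ 'n" and r :: nat
  assumes "left_stochastic M"
    and "rank M = r"
  shows "B5 M \<le> (real r)\<^sup>2 * (ln (real CARD('m)) + 1)"
proof -
  define w where "w i = (MAX k. M $ i $ k)" for i
  define W where "W = (\<Sum>i\<in>UNIV. w i)"
  have le_w: "M $ i $ k \<le> w i" for i k
    unfolding w_def by simp
  have w0: "0 \<le> w i" for i
    using assms(1) le_w order_trans unfolding left_stochastic_def by blast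
  have W0: "0 \<le> W"
    unfolding W_def by (simp add: sum_nonneg w0)
  \<comment> \<open>The numerator averages row \<open>i\<close>, hence is at most
    \<open>w i\<close>; the denominator is at least \<open>1 / W\<close>.\<close>
  have ratio: "B5_ratio M i q \<le> w i * W" if q: "prob_dist q" for i q
  proof -
    let ?D = "\<Sum>s\<in>UNIV. \<Sum>t\<in>UNIV. q $ s * q $ t * (fidelity (column s M) (column t M))\<^sup>2"
    have "(\<Sum>k\<in>UNIV. q $ k * M $ i $ k) \<le> (\<Sum>k\<in>UNIV. q $ k * w i)"
      using q by (intro sum_mono mult_left_mono le_w) (simp add: prob_dist_def)
    also have "\<dots> = w i"
      using q by (simp add: prob_dist_def flip: sum_distrib_right)
    also have "\<dots> \<le> w i * (W * sqrt ?D)"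
    proof -
      have "1 \<le> sqrt (W\<^sup>2 * ?D)"
        unfolding W_def using B5_denominator_ge[OF assms(1) q le_w] by simp
      then have "1 \<le> W * sqrt ?D"
        by (simp add: real_sqrt_mult W0)
      then show ?thesis
        using mult_left_mono[OF _ w0] by fastforce
    qed
    finally show ?thesis
      unfolding B5_ratio_def using B5_denominator_pos[OF assms(1) q]
      by (simp add: pos_divide_le_eq mult.assoc)
  qed
  have "B5 M \<le> (\<Sum>i\<in>UNIV. w i * W)"
    unfolding B5_def using ratio prob_dist_axis by (intro sum_mono cSUP_least) auto
  also have "\<dots> = W\<^sup>2"
    by (simp add: W_def power2_eq_square flip: sum_distrib_right)
  also have "\<dots> \<le> (real r)\<^sup>2"
    using sum_row_max_le_rank[OF assms(1)] assms(2) W0 unfolding W_def w_def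
    by (intro power_mono) auto
  \<comment> \<open>The index type is nonempty, so the logarithm is nonnegative.\<close>
  also have "\<dots> \<le> (real r)\<^sup>2 * (ln (real CARD('m)) + 1)"
    by (simp add: mult_le_cancel_left1 Suc_leI)
  finally show ?thesis .
qed

end
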